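(* Consider robots with chirality, each equipped with $1$ bit of persistent memory. There exists a universal algorithm solving \textsc{Visit-All}: a single algorithm such that from every initial configuration $C_0$ it solves \textsc{Visit-All} in $k$ steps for some $k\in\{1,2\}$ (depending only on $C_0$).
   Context: Model. There are $n\ge 2$ robots $r_0,\dots,r_{n-1}$, which are points in $\mathbb R^2$. A configuration is a tuple $C=(p_0,\dots,p_{n-1})$ of points, $p_i$ being the position of $r_i$ in a fixed global coordinate system unknown to the robots; an initial configuration consists of pairwise distinct points. Each robot $r_i$ has a local Cartesian coordinate system $Z_i$, always centred at its current position, whose orientation and unit length are fixed over time but arbitrary and possibly different for different robots. Chirality: all $Z_i$ have the same handedness (the robots agree on the clockwise direction). Each robot has one private bit $b\in\{0,1\}$ of persistent memory, initially $0$ for all robots and not visible to other robots; it has no other memory. Robots are anonymous and deterministic: an algorithm $\mathcal A$ is one function, the same for all robots, mapping a pair (snapshot, current value of own bit) to a pair (destination point in local coordinates, new value of own bit), where the snapshot is the multiset of positions of all robots expressed in the observing robot's local coordinate system, its own position being the origin. In each round all robots simultaneously take a snapshot, compute, update their bits, and move exactly to their destinations. Thus $C_0$ and $Z=(Z_0,\dots,Z_{n-1})$ determine the run $(C_0,C_1,C_2,\dots)$ of $\mathcal A$. Permutations. For a permutation $\pi$ of $\{0,\dots,n-1\}$ put $\pi(C)=(p_{\pi(0)},\dots,p_{\pi(n-1)})$. $\Pi_n$ is the set of permutations that are a single $n$-cycle. Problem. $\mathcal A$ solves \textsc{Visit-All} in $k$ steps from $C_0$ if for every admissible $Z$ the run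 from $C_0$ (all bits initially $0$) satisfies: there is $\pi\in\Pi_n$ with $C_{ik}=\pi^i(C_0)$ for all $i\ge 0$ (no constraint on the other configurations). *)

theory Defs
  imports "HOL-Analysis.Analysis" "HOL-Combinatorics.Orbits" "HOL-Library.Multiset"
begin

type_synonym point = "real^2"

(* The robots are 0, ..., n - 1. Only the values at indices i < n of a configuration,
   of the bits and of a family of frames matter; the others are junk. *)
type_synonym config = "nat \<Rightarrow> point"

(* The columns of a frame are the two axis vectors of a local coordinate system,
   each as long as its unit of length, written in global coordinates. The origin is not
   part of the frame, since it moves with the robot. *)
type_synonym frame = "real^2^2"

definition cartesian_frame :: "frame \<Rightarrow> bool" where
  "cartesian_frame M \<longleftrightarrow> (\<exists>u>0. \<exists>Q. orthogonal_matrix Q \<and> M = u *\<^sub>R Q)"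

(* Chirality: the frames agree with each other in handedness (the sign of the determinant).
   The common handedness itself is arbitrary with respect to the global system. *)
definition admissible_frames :: "nat \<Rightarrow> (nat \<Rightarrow> frame) \<Rightarrow> bool" where
  "admissible_frames n Z \<longleftrightarrow>
     (\<forall>i<n. cartesian_frame (Z i)) \<and>
     (\<forall>i<n. \<forall>j<n. sgn (det (Z i)) = sgn (det (Z j)))"

definition to_local :: "frame \<Rightarrow> point \<Rightarrow> point \<Rightarrow> point" where
  "to_local M p q = matrix_inv M *v (q - p)"

definition to_global :: "frame \<Rightarrow> point \<Rightarrow> point \<Rightarrow> point" where
  "to_global M p v = p + M *v v"

definition snapshot :: "nat \<Rightarrow> (nat \<Rightarrow> frame) \<Rightarrow> config \<Rightarrow> nat \<Rightarrow> point multiset" where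
  "snapshot n Z C i = image_mset (\<lambda>j. to_local (Z i) (C i) (C j)) (mset_set {..<n})"

(* The private bit is a bool, with False for 0 and True for 1. *)
type_synonym algorithm = "point multiset \<times> bool \<Rightarrow> point \<times> bool"

definition one_round :: "algorithm \<Rightarrow> nat \<Rightarrow> (nat \<Rightarrow> frame) \<Rightarrow>
    config \<times> (nat \<Rightarrow> bool) \<Rightarrow> config \<times> (nat \<Rightarrow> bool)" where
  "one_round A n Z = (\<lambda>(C, b).
     (\<lambda>i. to_global (Z i) (C i) (fst (A (snapshot n Z C i, b i))),
      \<lambda>i. snd (A (snapshot n Z C i, b i))))"

definition run :: "algorithm \<Rightarrow> nat \<Rightarrow> (nat \<Rightarrow> frame) \<Rightarrow> config \<Rightarrow> nat \<Rightarrow> config" where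
  "run A n Z C\<^sub>0 t = fst ((one_round A n Z ^^ t) (C\<^sub>0, \<lambda>_. False))"

definition initial_config :: "nat \<Rightarrow> config \<Rightarrow> bool" where
  "initial_config n C \<longleftrightarrow> inj_on C {..<n}"

definition n_cycles :: "nat \<Rightarrow> (nat \<Rightarrow> nat) set" where
  "n_cycles n = {\<pi>. \<pi> permutes {..<n} \<and> cyclic_on \<pi> {..<n}}"

definition solves_visit_all :: "algorithm \<Rightarrow> nat \<Rightarrow> nat \<Rightarrow> config \<Rightarrow> bool" where
  "solves_visit_all A n k C\<^sub>0 \<longleftrightarrow>
     (\<forall>Z. admissible_frames n Z \<longrightarrow>
       (\<exists>\<pi>\<in>n_cycles n. \<forall>i. \<forall>j<n. run A n Z C\<^sub>0 (i * k) j = C\<^sub>0 ((\<pi> ^^ i) j)))"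

end

(* Identify the plane with the complex numbers; with chirality, a change from global to local
   coordinates is then multiplication by a nonzero number followed by a translation. Let P be the set
   of occupied points and c its centroid.

   If c is not in P, ordering P by the polar angle around c (and by the distance from c along each
   ray) gives a cyclic order that all robots agree on, and everybody moves to the next point: k = 1.

   If c is in P, an n-cycle of P need not be definable from P alone. The robot at c breaks the
   symmetry: it chooses a point y at maximal distance from c and moves far out in the direction of y.
   From the resulting configuration everybody recovers (P, c, y), and the cyclic order of P in polar
   coordinates with origin c and reference direction y is an n-cycle: k = 2. So that the same y is
   used for ever, whoever reaches c or y in an even round keeps the bit 1. From then on
   the robot at c stays, and the robot at y moves far out, at a different distance, to reveal y again.
   In odd rounds all bits are 1 and the centroid is unoccupied, which never happens in even rounds. *)
theory Submission
  imports Defs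
begin

section \<open>Polar order around a centre, its successor relation, and n-cycles\<close>

definition polar_less :: "complex \<Rightarrow> complex \<Rightarrow> bool" where
  "polar_less a b \<longleftrightarrow> Arg2pi a < Arg2pi b \<or> Arg2pi a = Arg2pi b \<and> norm a < norm b"

definition cyc_between :: "complex \<Rightarrow> complex \<Rightarrow> complex \<Rightarrow> bool" where
  "cyc_between a b d \<longleftrightarrow> polar_less a b \<and> polar_less b d \<or> polar_less b d \<and> polar_less d a \<or>
     polar_less d a \<and> polar_less a b"

text \<open>Dividing by \<open>y - c\<close> turns the reference direction to angle 0 and makes the
  relation invariant under maps \<open>x \<mapsto> \<alpha> * x + \<beta>\<close>. Since
  \<open>Arg2pi 0 = 0\<close>, a centre \<open>c\<close> that belongs to \<open>P\<close> comes
  first in the order.\<close>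

definition is_next :: "complex set \<Rightarrow> complex \<Rightarrow> complex \<Rightarrow> complex \<Rightarrow> complex \<Rightarrow> bool" where
  "is_next P c y z w \<longleftrightarrow> w \<in> P \<and> w \<noteq> z \<and>
     (\<forall>u\<in>P. \<not> cyc_between ((z - c) / (y - c)) ((u - c) / (y - c)) ((w - c) / (y - c)))"

lemma polar_eqI: "Arg2pi a = Arg2pi b \<Longrightarrow> norm a = norm b \<Longrightarrow> a = b"
  by (metis Arg2pi_eq)

lemma polar_less_total: "a \<noteq> b \<Longrightarrow> polar_less a b \<or> polar_less b a"
  unfolding polar_less_def using polar_eqI by (metis linorder_neqE_linordered_idom)

lemma polar_less_trans: "polar_less a b \<Longrightarrow> polar_less b d \<Longrightarrow> polar_less a d"
  unfolding polar_less_def by auto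

lemma polar_less_irrefl: "\<not> polar_less a a"
  unfolding polar_less_def by auto

lemma Arg2pi_mult_cases:
  assumes "v \<noteq> 0" "z \<noteq> 0"
  shows "(Arg2pi (v * z) = Arg2pi v + Arg2pi z \<and> Arg2pi v + Arg2pi z < 2 * pi) \<or>
         (Arg2pi (v * z) = Arg2pi v + Arg2pi z - 2 * pi \<and> Arg2pi v + Arg2pi z \<ge> 2 * pi)"
proof (cases "Arg2pi v + Arg2pi z < 2 * pi")
  case True
  show ?thesis unfolding Arg2pi_times[OF assms] if_P[OF True] using True by blast
next
  case False
  show ?thesis unfolding Arg2pi_times[OF assms] if_not_P[OF False]
    using False by (simp only: not_less simp_thms)
qed

text \<open>Multiplication by \<open>v\<close> makes an angle wrap around exactly when it is at least
  \<open>2 * pi - Arg2pi v\<close>, so it moves a final segment of the polar order to the front.\<close>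

lemma polar_less_rotate:
  assumes "v \<noteq> 0" "a \<noteq> 0" "b \<noteq> 0"
  defines "W \<equiv> \<lambda>x. Arg2pi v + Arg2pi x \<ge> 2 * pi"
  shows "polar_less (v * a) (v * b) \<longleftrightarrow> (if W a = W b then polar_less a b else W a)"
    and "W a \<noteq> W b \<Longrightarrow> polar_less a b \<longleftrightarrow> W b"
proof -
  have n: "norm (v * a) < norm (v * b) \<longleftrightarrow> norm a < norm b"
    using assms(1) by (simp add: norm_mult)
  note A = Arg2pi_ge_0[of a] Arg2pi_lt_2pi[of a] Arg2pi_ge_0[of b] Arg2pi_lt_2pi[of b]
  show "polar_less (v * a) (v * b) \<longleftrightarrow> (if W a = W b then polar_less a b else W a)"
    using Arg2pi_mult_cases[OF assms(1,2)] Arg2pi_mult_cases[OF assms(1,3)] A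
    by (cases "W a"; cases "W b") (auto simp: polar_less_def n W_def)
  show "W a \<noteq> W b \<Longrightarrow> polar_less a b \<longleftrightarrow> W b"
    unfolding polar_less_def W_def using A by auto
qed

text \<open>Moving a final segment of a linear order to the front keeps the induced cyclic order.
  The origin is excluded because its angle stays 0 and does not turn along.\<close>

lemma cyc_between_rotate:
  assumes "v \<noteq> 0" "a \<noteq> 0" "b \<noteq> 0" "d \<noteq> 0"
  shows "cyc_between (v * a) (v * b) (v * d) \<longleftrightarrow> cyc_between a b d"
proof -
  define W where "W x \<longleftrightarrow> Arg2pi v + Arg2pi x \<ge> 2 * pi" for x
  note r = polar_less_rotate[OF assms(1), folded W_def]
  note r1 = r[OF assms(2,3)] r[OF assms(3,4)] r[OF assms(4,2)]
  show ?thesis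
    unfolding cyc_between_def r1(1,3,5) using r1(2,4,6)
    by (cases "W a"; cases "W b"; cases "W d") simp_all
qed

text \<open>A new reference multiplies all quotients by one number, and none of them is 0 because
  \<open>c\<close> is not in \<open>P\<close>. For \<open>c\<close> in \<open>P\<close> the
  reference can matter: it decides where \<open>c\<close> enters the cycle.\<close>

lemma is_next_reference:
  assumes "c \<notin> P" "z \<in> P" "y \<noteq> c" "y' \<noteq> c"
  shows "is_next P c y z w \<longleftrightarrow> is_next P c y' z w"
proof -
  define v where "v = (y' - c) / (y - c)"
  have v: "v \<noteq> 0" using assms by (simp add: v_def)
  have r: "(x - c) / (y - c) = v * ((x - c) / (y' - c))" for x
    using assms by (simp add: v_def)
  have nz: "(x - c) / (y' - c) \<noteq> 0" if "x \<in> P" for x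
    using assms that by auto
  show ?thesis
    unfolding is_next_def r
    using cyc_between_rotate[OF v] nz assms(2) by blast
qed

lemma is_next_affine:
  assumes "\<alpha> \<noteq> 0" "is_next P c y z w"
  shows "is_next ((\<lambda>x. \<alpha> * x + \<beta>) ` P) (\<alpha> * c + \<beta>) (\<alpha> * y + \<beta>) (\<alpha> * z + \<beta>) (\<alpha> * w + \<beta>)"
proof -
  have "(\<alpha> * x + \<beta> - (\<alpha> * c + \<beta>)) / (\<alpha> * y + \<beta> - (\<alpha> * c + \<beta>)) = (x - c) / (y - c)" for x
    using assms(1) by (simp add: right_diff_distrib[symmetric])
  then show ?thesis using assms unfolding is_next_def by auto
qed

text \<open>The condition of \<open>is_next\<close>, carried over to ranks. The decisive value of
  \<open>k\<close> is the candidate successor itself: 0 if \<open>i\<close> is the last index,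
  \<open>i + 1\<close> otherwise.\<close>

lemma nat_cyc_succ:
  fixes i j n :: nat
  assumes "i < n" "j < n" "j \<noteq> i" "2 \<le> n"
  shows "j = (i + 1) mod n \<longleftrightarrow>
    (\<forall>k<n. \<not> (i < k \<and> k < j \<or> k < j \<and> j < i \<or> j < i \<and> i < k))"
proof (cases "i + 1 = n")
  case True
  then have m: "(i + 1) mod n = 0" by simp
  show ?thesis unfolding m
  proof
    assume "j = 0" then show "\<forall>k<n. \<not> (i < k \<and> k < j \<or> k < j \<and> j < i \<or> j < i \<and> i < k)"
      using True by auto
  next
    assume "\<forall>k<n. \<not> (i < k \<and> k < j \<or> k < j \<and> j < i \<or> j < i \<and> i < k)"
    from this[rule_format, of 0] show "j = 0" using assms True by auto
  qed
next
  case False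
  then have m: "(i + 1) mod n = i + 1" using assms by simp
  show ?thesis unfolding m
  proof
    assume "j = i + 1" then show "\<forall>k<n. \<not> (i < k \<and> k < j \<or> k < j \<and> j < i \<or> j < i \<and> i < k)"
      by auto
  next
    assume "\<forall>k<n. \<not> (i < k \<and> k < j \<or> k < j \<and> j < i \<or> j < i \<and> i < k)"
    from this[rule_format, of "i + 1"] show "j = i + 1" using assms False by auto
  qed
qed

lemma is_next_enumeration:
  assumes "finite P" "card P = n" "n \<ge> 2" "y \<noteq> c"
  obtains e where "bij_betw e {..<n} P"
    "\<And>i w. i < n \<Longrightarrow> is_next P c y (e i) w \<longleftrightarrow> w = e ((i + 1) mod n)"
proof -
  define \<rho> where "\<rho> x = (x - c) / (y - c)" for x
  \<comment> \<open>The rank of \<open>z\<close> in the polar order. Ranks map \<open>P\<close>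
    bijectively onto \<open>{..<n}\<close>, and the enumeration is the inverse map.\<close>
  define idx where "idx z = card {u \<in> P. polar_less (\<rho> u) (\<rho> z)}" for z
  have rinj: "\<rho> u \<noteq> \<rho> v" if "u \<noteq> v" for u v
    using that assms(4) by (simp add: \<rho>_def)
  have mono: "idx u < idx v" if "u \<in> P" "v \<in> P" "polar_less (\<rho> u) (\<rho> v)" for u v
  proof -
    have "{x \<in> P. polar_less (\<rho> x) (\<rho> u)} \<subset> {x \<in> P. polar_less (\<rho> x) (\<rho> v)}"
      using that polar_less_trans polar_less_irrefl by blast
    then show ?thesis unfolding idx_def using assms(1) by (intro psubset_card_mono) auto
  qed
  have idx_iff: "idx u < idx v \<longleftrightarrow> polar_less (\<rho> u) (\<rho> v)" if "u \<in> P" "v \<in> P" for u v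
    using mono[OF that] mono[OF that(2,1)] polar_less_total[OF rinj, of u v]
    by (cases "u = v") (auto simp: polar_less_irrefl)
  have inj: "inj_on idx P"
    by (rule inj_onI) (metis idx_iff less_irrefl polar_less_total rinj)
  have "idx u < n" if "u \<in> P" for u
    unfolding idx_def assms(2)[symmetric]
    using that assms(1) polar_less_irrefl by (intro psubset_card_mono) auto
  then have "idx ` P \<subseteq> {..<n}" by auto
  then have "idx ` P = {..<n}"
    using card_image[OF inj] assms(2) by (intro card_subset_eq) auto
  with inj have bij: "bij_betw idx P {..<n}" by (simp add: bij_betw_def)
  let ?e = "inv_into P idx"
  have be: "bij_betw ?e {..<n} P" using bij by (rule bij_betw_inv_into)
  have ie: "idx (?e i) = i" if "i < n" for i
    using bij that by (simp add: bij_betw_inv_into_right)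
  have eP: "?e i \<in> P" if "i < n" for i
    using be that by (auto simp: bij_betw_def)
  have "is_next P c y (?e i) w \<longleftrightarrow> w = ?e ((i + 1) mod n)" if i: "i < n" for i w
  proof (cases "w \<in> P \<and> w \<noteq> ?e i")
    case True
    then have w: "w \<in> P" "idx w < n" "idx w \<noteq> i"
      using bij i bij_betw_inv_into_left[OF bij] by (auto simp: bij_betw_def)
    have "is_next P c y (?e i) w \<longleftrightarrow> (\<forall>u\<in>P. \<not> (i < idx u \<and> idx u < idx w \<or>
        idx u < idx w \<and> idx w < i \<or> idx w < i \<and> i < idx u))"
    proof -
      have "cyc_between (\<rho> (?e i)) (\<rho> u) (\<rho> w) \<longleftrightarrow> (i < idx u \<and> idx u < idx w \<or>
        idx u < idx w \<and> idx w < i \<or> idx w < i \<and> i < idx u)" if "u \<in> P" for u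
        unfolding cyc_between_def using idx_iff[OF eP[OF i] that] idx_iff[OF that w(1)]
          idx_iff[OF w(1) eP[OF i]] ie[OF i] by simp
      then show ?thesis using True unfolding is_next_def \<rho>_def by blast
    qed
    also have "\<dots> \<longleftrightarrow> (\<forall>k<n. \<not> (i < k \<and> k < idx w \<or> k < idx w \<and> idx w < i \<or> idx w < i \<and> i < k))"
      unfolding lessThan_iff[symmetric] Ball_def[symmetric] \<open>idx ` P = {..<n}\<close>[symmetric] by blast
    also have "\<dots> \<longleftrightarrow> idx w = (i + 1) mod n"
      using nat_cyc_succ[OF i w(2,3) assms(3)] by simp
    also have "\<dots> \<longleftrightarrow> w = ?e ((i + 1) mod n)"
      using w ie[of "(i + 1) mod n"] assms(3) bij_betw_inv_into_left[OF bij w(1)]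
      by (metis gr_zeroI mod_less_divisor not_numeral_le_zero)
    finally show ?thesis .
  next
    case False
    \<comment> \<open>Here \<open>is_next\<close> fails outright; the right-hand side fails too,
      since \<open>n \<ge> 2\<close> makes the successor index differ from \<open>i\<close>.\<close>
    have "(i + 1) mod n < n" using assms(3) by simp
    moreover have "(i + 1) mod n \<noteq> i"
      using i assms(3) by (cases "i + 1 = n") auto
    ultimately have "?e ((i + 1) mod n) \<in> P" "?e ((i + 1) mod n) \<noteq> ?e i"
      using eP ie i by metis+
    with False show ?thesis unfolding is_next_def by auto
  qed
  with be show ?thesis using that by blast
qed

lemma n_cycle_of_successor:
  assumes "inj_on C {..<n}" "C ` {..<n} = P" "n \<ge> 2" "bij_betw e {..<n} P"
    and \<sigma>: "\<And>i. i < n \<Longrightarrow> \<sigma> (e i) = e ((i + 1) mod n)"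
  shows "\<exists>\<pi>\<in>n_cycles n. \<forall>j<n. C (\<pi> j) = \<sigma> (C j)"
proof -
  have bC: "bij_betw C {..<n} P" using assms by (simp add: bij_betw_def)
  define \<pi> where "\<pi> j = (if j < n then inv_into {..<n} C (\<sigma> (C j)) else j)" for j
  \<comment> \<open>\<open>h i\<close> is the robot standing at the point with index
    \<open>i\<close>; it conjugates \<open>\<pi>\<close> to the shift modulo
    \<open>n\<close>.\<close>
  define h where "h i = inv_into {..<n} C (e i)" for i
  have bh: "bij_betw h {..<n} {..<n}"
    unfolding h_def using bij_betw_trans[OF assms(4) bij_betw_inv_into[OF bC]]
    by (simp add: comp_def)
  have Ch: "C (h i) = e i" if "i < n" for i
    unfolding h_def using that bij_betw_inv_into_right[OF bC] bij_betwE[OF assms(4)] by simp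
  have hn: "h i < n" if "i < n" for i using bh that by (auto simp: bij_betw_def)
  have ph: "\<pi> (h i) = h ((i + 1) mod n)" if "i < n" for i
    using that hn Ch \<sigma> by (simp add: \<pi>_def h_def)
  have ex: "\<exists>i<n. j = h i" if "j < n" for j
    using bij_betw_imp_surj_on[OF bh] that by (metis imageE lessThan_iff)
  have n0: "i mod n < n" for i using assms(3) by simp
  have C\<pi>: "C (\<pi> j) = \<sigma> (C j)" if j: "j < n" for j
  proof -
    obtain i where "i < n" "j = h i" using ex[OF j] by blast
    then show ?thesis using ph Ch \<sigma> n0 by simp
  qed
  have orb: "h (k mod n) \<in> orbit \<pi> (h 0)" for k
  proof (induction k)
    case 0
    have "\<pi> (h (n - 1)) = h 0" using ph[of "n - 1"] assms(3) by simp
    \<comment> \<open>\<open>orbit\<close> collects the iterates from the first one on, so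
      \<open>h 0\<close> itself is reached only after a full turn.\<close>
    have *: "h (Suc k mod n) \<in> orbit \<pi> (h 0)" for k
    proof (induction k)
      case 0 show ?case using ph[of 0] orbit.base[of \<pi> "h 0"] assms(3) by simp
    next
      case (Suc k) then show ?case
        using ph[OF n0, of "Suc k"] orbit.step[of "h (Suc k mod n)" \<pi> "h 0"] by (simp add: mod_Suc_eq)
    qed
    from *[of "n - 1"] assms(3) show ?case by simp
  next
    case (Suc k) then show ?case
      using ph[OF n0, of k] orbit.step[of "h (k mod n)" \<pi> "h 0"] by (simp add: mod_Suc_eq)
  qed
  have h0: "h 0 \<in> {..<n}" using hn assms(3) by simp
  have maps: "\<pi> j < n" if "j < n" for j
    using ex[OF that] ph hn n0 by auto
  have "orbit \<pi> (h 0) = {..<n}"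
  proof
    show "orbit \<pi> (h 0) \<subseteq> {..<n}"
    proof
      fix x assume "x \<in> orbit \<pi> (h 0)"
      then show "x \<in> {..<n}" by induction (use h0 maps in auto)
    qed
    show "{..<n} \<subseteq> orbit \<pi> (h 0)"
      using ex orb by (metis lessThan_iff mod_less subsetI)
  qed
  then have cyc: "cyclic_on \<pi> {..<n}" unfolding cyclic_on_def using h0 by blast
  have "{..<n} \<subseteq> \<pi> ` {..<n}"
  proof
    fix x assume "x \<in> {..<n}"
    then obtain i where i: "i < n" "x = h i" using ex by auto
    \<comment> \<open>The cyclic predecessor of \<open>i\<close>; adding \<open>n\<close> first
      avoids truncated subtraction at \<open>i = 0\<close>.\<close>
    have "\<pi> (h ((i + n - 1) mod n)) = h ((((i + n - 1) mod n) + 1) mod n)"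
      using ph[OF n0] .
    also have "(((i + n - 1) mod n) + 1) mod n = i"
      using i assms(3) by (simp add: mod_Suc_eq)
    finally show "x \<in> \<pi> ` {..<n}" using i hn n0 by (metis imageI lessThan_iff)
  qed
  then have "\<pi> ` {..<n} = {..<n}" using maps by auto
  then have "bij_betw \<pi> {..<n} {..<n}"
    by (simp add: bij_betw_def finite_surj_inj)
  then have "\<pi> permutes {..<n}"
    by (rule bij_imp_permutes) (simp add: \<pi>_def)
  with cyc C\<pi> show ?thesis unfolding n_cycles_def by blast
qed

section \<open>Configurations with one displaced robot, and the recovery of (P, c, y)\<close>

definition centroid :: "complex set \<Rightarrow> complex" where
  "centroid S = \<Sum>S / of_nat (card S)"

lemma centroid_affine:
  assumes "finite S" "S \<noteq> {}" "\<alpha> \<noteq> 0"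
  shows "centroid ((\<lambda>x. \<alpha> * x + \<beta>) ` S) = \<alpha> * centroid S + \<beta>"
proof -
  have inj: "inj_on (\<lambda>x. \<alpha> * x + \<beta>) S" using assms by (auto intro: inj_onI)
  have "card S \<noteq> 0" using assms by simp
  then show ?thesis
    unfolding centroid_def card_image[OF inj] sum.reindex[OF inj]
    by (simp add: sum.distrib sum_distrib_left[symmetric] add_divide_distrib)
qed

text \<open>Maximality confines \<open>P\<close> to the disc of radius \<open>norm (y - c)\<close>
  around \<open>c\<close>, the scale for the displacements below; \<open>y \<noteq> c\<close> makes
  \<open>y - c\<close> a usable direction. Ties are possible, hence a relation.\<close>

definition farthest :: "complex set \<Rightarrow> complex \<Rightarrow> complex \<Rightarrow> bool" where
  "farthest P c y \<longleftrightarrow> y \<in> P \<and> y \<noteq> c \<and> (\<forall>x\<in>P. norm (x - c) \<le> norm (y - c))"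

lemma farthest_affine:
  assumes "\<alpha> \<noteq> 0" "farthest P c y"
  shows "farthest ((\<lambda>x. \<alpha> * x + \<beta>) ` P) (\<alpha> * c + \<beta>) (\<alpha> * y + \<beta>)"
proof -
  have "\<alpha> * x + \<beta> - (\<alpha> * c + \<beta>) = \<alpha> * (x - c)" for x by (simp add: algebra_simps)
  with assms show ?thesis unfolding farthest_def by (auto simp: norm_mult)
qed

lemma farthest_exists:
  assumes "finite P" "card P \<ge> 2"
  shows "\<exists>y. farthest P c y"
proof -
  have "P \<noteq> {}" "\<not> P \<subseteq> {c}"
    using assms card_mono[of "{c}" P] by auto
  then obtain x where x: "x \<in> P" "x \<noteq> c" by blast
  let ?f = "\<lambda>x. norm (x - c)"
  have "Max (?f ` P) \<in> ?f ` P" using assms(1) x by (intro Max_in) auto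
  then obtain y where y: "y \<in> P" "?f y = Max (?f ` P)" by auto
  then have m: "\<forall>x\<in>P. ?f x \<le> ?f y" using assms(1) by auto
  then have "y \<noteq> c" using x by (metis diff_self norm_le_zero_iff norm_zero right_minus_eq)
  then show ?thesis using m y(1) unfolding farthest_def by blast
qed

text \<open>The factors \<open>2 n\<close> and \<open>4 n\<close> make the displaced robot an outlier, tell the two cases apart,
  and keep the centroid of the displaced configuration unoccupied.\<close>

definition encodes :: "complex set \<Rightarrow> complex set \<Rightarrow> complex \<Rightarrow> complex \<Rightarrow> bool" where
  "encodes S P c y \<longleftrightarrow> finite P \<and> c \<in> P \<and> centroid P = c \<and> farthest P c y \<and>
     (S = insert (c + of_nat (2 * card P) * (y - c)) (P - {c}) \<or>
      S = insert (c + of_nat (4 * card P) * (y - c)) (P - {y}))"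

lemma encodes_affine:
  assumes "\<alpha> \<noteq> 0" "encodes S P c y"
  shows "encodes ((\<lambda>x. \<alpha> * x + \<beta>) ` S) ((\<lambda>x. \<alpha> * x + \<beta>) ` P) (\<alpha> * c + \<beta>) (\<alpha> * y + \<beta>)"
proof -
  let ?f = "\<lambda>x. \<alpha> * x + \<beta>"
  have inj: "inj ?f" using assms by (auto intro: injI)
  note e = assms(2)[unfolded encodes_def]
  have card: "card (?f ` P) = card P" using inj by (intro card_image) (auto intro: inj_on_subset)
  have im: "?f ` (insert (c + k * (y - c)) (P - {z})) =
     insert (?f c + k * (?f y - ?f c)) (?f ` P - {?f z})" for k z
    using image_set_diff[OF inj, of P "{z}"] by (simp add: algebra_simps)
  have "P \<noteq> {}" using e by auto
  then have "centroid (?f ` P) = ?f c"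
    using e assms(1) centroid_affine[of P \<alpha> \<beta>] by simp
  moreover have "farthest (?f ` P) (?f c) (?f y)"
    using e farthest_affine[OF assms(1)] by blast
  moreover have "?f ` S = insert (?f c + of_nat (2 * card (?f ` P)) * (?f y - ?f c)) (?f ` P - {?f c}) \<or>
      ?f ` S = insert (?f c + of_nat (4 * card (?f ` P)) * (?f y - ?f c)) (?f ` P - {?f y})"
    unfolding im[symmetric] card using e by metis
  moreover have "finite (?f ` P)" "?f c \<in> ?f ` P" using e by auto
  ultimately show ?thesis unfolding encodes_def by (intro conjI)
qed

lemma centroid_sum: "finite P \<Longrightarrow> c \<in> P \<Longrightarrow> centroid P = c \<Longrightarrow> \<Sum>P = of_nat (card P) * c"
  unfolding centroid_def by (auto simp: field_simps)

text \<open>The centroid of two points is their midpoint, which is neither of them.\<close>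

lemma card_ge_3:
  assumes "finite P" "c \<in> P" "centroid P = c" "farthest P c y"
  shows "card P \<ge> 3"
proof (rule ccontr)
  assume "\<not> ?thesis"
  moreover have y: "{c, y} \<subseteq> P" "y \<noteq> c" using assms by (auto simp: farthest_def)
  moreover have "card {c, y} \<le> card P" using y assms(1) by (intro card_mono) auto
  ultimately have "P = {c, y}" "card P = 2"
    using assms(1) card_subset_eq[of P "{c, y}"] by auto
  with centroid_sum[OF assms(1-3)] y(2) show False by (auto simp: algebra_simps)
qed

definition outlier :: "complex set \<Rightarrow> complex \<Rightarrow> bool" where
  "outlier S s \<longleftrightarrow> s \<in> S \<and> (\<forall>u\<in>S - {s}. \<forall>v\<in>S - {s}. norm (u - v) < norm (s - u))"

text \<open>With two outliers, a third point \<open>z\<close> would be nearer to \<open>s'\<close>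
  than to \<open>s\<close> and also nearer to \<open>s\<close> than to \<open>s'\<close>.\<close>

lemma outlier_unique:
  assumes "outlier S s" "outlier S s'" "finite S" "card S \<ge> 3"
  shows "s = s'"
proof (rule ccontr)
  assume ne: "s \<noteq> s'"
  have "\<not> S \<subseteq> {s, s'}" using assms(4) card_mono[of "{s, s'}" S] ne by auto
  then obtain z where z: "z \<in> S" "z \<noteq> s" "z \<noteq> s'" by blast
  have "norm (z - s') < norm (s - z)" "norm (z - s) < norm (s' - z)"
    using assms(1,2) ne z unfolding outlier_def by auto
  then show False by (simp add: norm_minus_commute)
qed

lemma far_notin:
  assumes "farthest P c y" "k > 1"
  shows "c + of_real k * (y - c) \<notin> P"
proof
  assume "c + of_real k * (y - c) \<in> P"
  then have "k * norm (y - c) \<le> norm (y - c)"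
    using assms unfolding farthest_def by (force simp: norm_mult)
  moreover have "norm (y - c) > 0" using assms by (simp add: farthest_def)
  ultimately show False using assms(2) by simp
qed

text \<open>With R = \<open>norm (y - c)\<close>, points of \<open>P\<close> are at most 2 R apart,
  whereas the displaced point is at distance at least (k - 1) R > 2 R from each of them.\<close>

lemma far_outlier:
  assumes "farthest P c y" "k > 3" "T \<subseteq> P"
  shows "outlier (insert (c + of_real k * (y - c)) T) (c + of_real k * (y - c))"
proof -
  have "norm (u - v) < norm (c + of_real k * (y - c) - u)" if "u \<in> P" "v \<in> P" for u v
  proof -
    let ?R = "norm (y - c)"
    have R: "?R > 0" "norm (u - c) \<le> ?R" "norm (v - c) \<le> ?R"
      using assms that by (auto simp: farthest_def)
    have "norm (u - v) \<le> 2 * ?R"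
      using R norm_triangle_ineq4[of "u - c" "v - c"] by simp
    moreover have "norm (of_real k * (y - c)) = k * ?R"
      using assms by (simp add: norm_mult)
    then have "k * ?R - ?R \<le> norm (c + of_real k * (y - c) - u)"
      using R norm_triangle_ineq2[of "of_real k * (y - c)" "u - c"] by (simp add: algebra_simps)
    moreover have "3 * ?R < k * ?R" using R assms by simp
    ultimately show ?thesis by linarith
  qed
  then show ?thesis using assms(3) unfolding outlier_def by auto
qed

text \<open>A common form of both displacements: the points of \<open>T\<close> stay and
  \<open>s\<close> is the outlier. As \<open>s\<close> lies outside \<open>P\<close>, no two robots
  collide and \<open>card S\<close> still tells \<open>card P\<close>.\<close>

lemma encodes_cases:
  assumes "encodes S P c y"
  obtains T s where "S = insert s T" "s \<notin> P" "T \<subseteq> P" "finite S" "card S = card P" "outlier S s"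
    "T = P - {c} \<and> s = c + of_nat (2 * card P) * (y - c) \<or>
     T = P - {y} \<and> s = c + of_nat (4 * card P) * (y - c)"
proof -
  note e = assms[unfolded encodes_def]
  have n: "card P \<ge> 3" using e card_ge_3 by blast
  obtain k :: nat and z where k: "z \<in> P" "S = insert (c + of_nat k * (y - c)) (P - {z})"
      "k = 2 * card P \<and> z = c \<or> k = 4 * card P \<and> z = y"
    using e unfolding farthest_def by blast
  let ?s = "c + of_nat k * (y - c)"
  have k3: "real k > 3" using k n by auto
  have f: "farthest P c y" using e by blast
  have s: "?s \<notin> P" using far_notin[OF f, of "real k"] k3 by simp
  have o: "outlier S ?s" using far_outlier[OF f k3, of "P - {z}"] k by auto
  have c: "card S = card P" using k s e by (simp add: card_Diff_singleton n) (use n in linarith)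
  show ?thesis
    using that[of ?s "P - {z}"] k s o c e by auto
qed

text \<open>With n points and d = y - c, the centroid moves from c to c + 2 d in the first case and
  to c + (4 - 1/n) d in the second. On the ray from c through y this is beyond every point of
  \<open>P\<close> but short of \<open>s\<close>.\<close>

lemma centroid_encodes:
  assumes "encodes S P c y"
  shows "centroid S \<notin> S"
proof -
  note e = assms[unfolded encodes_def]
  let ?n = "card P"
  let ?d = "y - c"
  have f: "farthest P c y" using e by blast
  have d: "?d \<noteq> 0" "y \<in> P" using f by (auto simp: farthest_def)
  have n: "?n \<ge> 3" using e card_ge_3 by blast
  obtain T s where T: "S = insert s T" "s \<notin> P" "T \<subseteq> P" "finite S" "card S = card P" "outlier S s"
    and c: "T = P - {c} \<and> s = c + of_nat (2 * card P) * (y - c) \<or>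
     T = P - {y} \<and> s = c + of_nat (4 * card P) * (y - c)"
    by (rule encodes_cases[OF assms])
  have S: "\<Sum>S = s + \<Sum>T" using T by (subst T(1), subst sum.insert) auto
  have nz: "(of_nat ?n :: complex) \<noteq> 0" using n by auto
  have nR: "1 / real ?n < 1" using n by simp
  have cS: "centroid S = x" if "\<Sum>S = of_nat ?n * x" for x
    using that nz T(5) by (simp add: centroid_def)
  have P: "\<Sum>P = of_nat ?n * c" using e centroid_sum by blast
  \<comment> \<open>\<open>k\<close> and \<open>m\<close> are the positions of the centroid and of
    \<open>s\<close> on the ray, in units of \<open>?d\<close>.\<close>
  obtain k m :: real where k: "k > 1" "k < m" "centroid S = c + of_real k * ?d" "s = c + of_real m * ?d"
    using c
  proof (elim disjE conjE)
    assume t: "T = P - {c}" and s: "s = c + of_nat (2 * card P) * (y - c)"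
    have "\<Sum>P = c + \<Sum>T" unfolding t by (rule sum.remove) (use e in auto)
    then have "\<Sum>T = of_nat ?n * c - c" unfolding P by (simp add: algebra_simps)
    then have "\<Sum>S = of_nat ?n * (c + of_real 2 * ?d)"
      unfolding S s by (simp add: algebra_simps)
    then have "centroid S = c + of_real 2 * ?d" by (rule cS)
    then show ?thesis using that[of 2 "2 * real ?n"] n s by simp
  next
    assume t: "T = P - {y}" and s: "s = c + of_nat (4 * card P) * (y - c)"
    have "\<Sum>P = y + \<Sum>T" unfolding t by (rule sum.remove) (use e d in auto)
    then have T': "\<Sum>T = of_nat ?n * c - y" unfolding P by (simp add: algebra_simps)
    have "\<Sum>S = of_nat ?n * c + 4 * (of_nat ?n * ?d) - ?d"
      unfolding S s T' by simp
    also have "\<dots> = of_nat ?n * (c + of_real (4 - 1 / real ?n) * ?d)"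
      using nz by (simp add: distrib_left left_diff_distrib right_diff_distrib)
    finally have "centroid S = c + of_real (4 - 1 / real ?n) * ?d" by (rule cS)
    moreover have "4 - 1 / real ?n > 1" using nR by linarith
    moreover have "1 / real ?n \<ge> 0" by simp
    then have "4 - 1 / real ?n < 4 * real ?n" using n by linarith
    ultimately show ?thesis using that[of "4 - 1 / real ?n" "4 * real ?n"] s by simp
  qed
  have "centroid S \<notin> P" using far_notin[OF f k(1)] k(3) by simp
  moreover have "centroid S \<noteq> s"
    using k d by simp
  ultimately show ?thesis using T by auto
qed


text \<open>\<open>S\<close> determines the outlier \<open>s\<close> and the rest \<open>T\<close>.
  Within each kind of displacement, the centroid equation and the formula for \<open>s\<close> form
  a nonsingular linear system for \<open>c\<close> and \<open>y\<close>; \<open>mixed\<close> shows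
  by comparing lengths that \<open>S\<close> cannot be of both kinds.\<close>

lemma encodes_unique:
  assumes "encodes S P c y" "encodes S P' c' y'"
  shows "P = P' \<and> c = c' \<and> y = y'"
proof -
  note e = assms(1)[unfolded encodes_def] and e' = assms(2)[unfolded encodes_def]
  have f: "farthest P c y" and f': "farthest P' c' y'" using e e' by blast+
  note d = f[unfolded farthest_def] f'[unfolded farthest_def]
  have n: "card P \<ge> 3" using e card_ge_3 by blast
  obtain T s where T: "S = insert s T" "s \<notin> P" "T \<subseteq> P" "finite S" "card S = card P" "outlier S s"
    and c: "T = P - {c} \<and> s = c + of_nat (2 * card P) * (y - c) \<or>
     T = P - {y} \<and> s = c + of_nat (4 * card P) * (y - c)"
    by (rule encodes_cases[OF assms(1)])
  obtain T' s' where T': "S = insert s' T'" "s' \<notin> P'" "T' \<subseteq> P'" "finite S" "card S = card P'" "outlier S s'"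
    and c': "T' = P' - {c'} \<and> s' = c' + of_nat (2 * card P') * (y' - c') \<or>
     T' = P' - {y'} \<and> s' = c' + of_nat (4 * card P') * (y' - c')"
    by (rule encodes_cases[OF assms(2)])
  have ss: "s' = s" using outlier_unique[OF T'(6) T(6,4)] T(5) n by simp
  have "T' = S - {s}" "T = S - {s}" using T T' ss by auto
  then have TT: "T' = T" by simp
  have nn: "card P' = card P" using T(5) T'(5) by simp
  \<comment> \<open>The norms of \<open>m\<close>, \<open>m - 1\<close> and
    \<open>4 * m * (m - 1) + 1\<close> show that these factors are nonzero, and are compared again
    in \<open>mixed\<close>.\<close>
  define m :: complex where "m = of_nat (card P)"
  have nm: "norm m = real (card P)" by (simp add: m_def)
  have m1: "norm (m - 1) = real (card P) - 1"
  proof -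
    have "m - 1 = of_real (real (card P) - 1)" by (simp add: m_def)
    moreover have "real (card P) - 1 \<ge> 0" using n by simp
    ultimately show ?thesis by (simp only: norm_of_real abs_of_nonneg)
  qed
  have m4: "norm (4 * m * (m - 1) + 1) = 4 * real (card P) * (real (card P) - 1) + 1"
  proof -
    have "4 * m * (m - 1) + 1 = of_real (4 * real (card P) * (real (card P) - 1) + 1)"
      by (simp add: m_def)
    moreover have "4 * real (card P) * (real (card P) - 1) + 1 \<ge> 0" using n by simp
    ultimately show ?thesis by (simp only: norm_of_real abs_of_nonneg)
  qed
  have m0: "m \<noteq> 0" "m - 1 \<noteq> 0" "4 * m * (m - 1) + 1 \<noteq> 0"
  proof -
    have "norm m > 0" "norm (m - 1) > 0" unfolding nm m1 using n by simp_all
    moreover have "norm (4 * m * (m - 1) + 1) > 0"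
      unfolding m4 using n by (intro add_nonneg_pos) auto
    ultimately show "m \<noteq> 0" "m - 1 \<noteq> 0" "4 * m * (m - 1) + 1 \<noteq> 0"
      by (simp_all only: zero_less_norm_iff not_False_eq_True)
  qed
  have sumP: "\<Sum>P = m * c" "\<Sum>P' = m * c'"
    using e e' centroid_sum nn unfolding m_def by metis+
  have rem: "\<Sum>P = z + \<Sum>(P - {z})" if "z \<in> P" for z
    using e that by (intro sum.remove) auto
  have rem': "\<Sum>P' = z + \<Sum>(P' - {z})" if "z \<in> P'" for z
    using e' that by (intro sum.remove) auto
  \<comment> \<open>\<open>c1\<close> is displaced in \<open>Q\<close> and \<open>y2\<close> in
    \<open>R\<close>. The centroid equations give \<open>(m - 1) * (c2 - c1) = y2 - c2\<close>, so
    the centres are at most r apart. As \<open>y1\<close> remains in \<open>T\<close>, it is within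
    r of \<open>c2\<close>, hence within 2 r of \<open>c1\<close>. Equating the two formulas for
    \<open>s\<close> then contradicts this bound, because of the summand 1 in
    \<open>4 * m * (m - 1) + 1\<close>.\<close>
  have mixed: False
    if "finite Q" "c1 \<in> Q" "farthest Q c1 y1" "T = Q - {c1}" "s = c1 + 2 * m * (y1 - c1)"
       "m * c1 = c1 + \<Sum>T"
       "farthest R c2 y2" "T = R - {y2}" "s = c2 + 4 * m * (y2 - c2)" "m * c2 = y2 + \<Sum>T"
    for Q R c1 c2 y1 y2
  proof -
    define r where "r = norm (y2 - c2)"
    have "y1 \<in> T" using that by (auto simp: farthest_def)
    then have y1: "norm (y1 - c2) \<le> r" using that by (auto simp: farthest_def r_def)
    have r: "r > 0" using that by (auto simp: farthest_def r_def)
    have a: "(m - 1) * (c2 - c1) = y2 - c2"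
      using that(6,10) by (simp add: algebra_simps)
    then have "(real (card P) - 1) * norm (c2 - c1) = r"
      unfolding r_def by (metis m1 norm_mult)
    moreover have "2 * norm (c2 - c1) \<le> (real (card P) - 1) * norm (c2 - c1)"
      using n by (intro mult_right_mono) auto
    ultimately have "norm (c2 - c1) \<le> r" using r by linarith
    then have b: "norm (y1 - c1) \<le> 2 * r"
      using y1 norm_triangle_ineq[of "y1 - c2" "c2 - c1"] by simp
    have "2 * m * (m - 1) * (y1 - c1) = (m - 1) * (s - c1)" using that(5) by (simp add: mult.assoc)
    also have "\<dots> = (m - 1) * (c2 - c1) + 4 * m * (m - 1) * (y2 - c2)"
      unfolding that(9) by (simp add: algebra_simps)
    also have "\<dots> = (4 * m * (m - 1) + 1) * (y2 - c2)" unfolding a by (simp add: algebra_simps)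
    finally have "norm (2 * m * (m - 1) * (y1 - c1)) = norm ((4 * m * (m - 1) + 1) * (y2 - c2))"
      by simp
    moreover have "norm (2 * m * (m - 1)) = 2 * real (card P) * (real (card P) - 1)"
      by (simp add: norm_mult nm m1)
    ultimately have "2 * real (card P) * (real (card P) - 1) * norm (y1 - c1) =
        (4 * real (card P) * (real (card P) - 1) + 1) * r"
      unfolding r_def by (simp only: norm_mult[of _ "y1 - c1"] norm_mult[of _ "y2 - c2"] m4)
    moreover have "2 * real (card P) * (real (card P) - 1) * norm (y1 - c1) \<le>
        2 * real (card P) * (real (card P) - 1) * (2 * r)"
      using b n by (intro mult_left_mono) auto
    ultimately show False using r by (simp add: algebra_simps)
  qed
  show ?thesis
    using c c' unfolding ss TT nn
  proof (elim disjE conjE)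
    assume t: "T = P - {c}" and s: "s = c + of_nat (2 * card P) * (y - c)"
      and t': "T = P' - {c'}" and s': "s = c' + of_nat (2 * card P) * (y' - c')"
    have "m * c = c + \<Sum>T" "m * c' = c' + \<Sum>T"
      unfolding sumP[symmetric] using rem[of c] rem'[of c'] e e' t t' by simp_all
    then have "(m - 1) * c = (m - 1) * c'" by (simp add: algebra_simps)
    then have cc: "c = c'" using m0 by simp
    then have "2 * m * (y - c) = 2 * m * (y' - c)"
      using s s' by (auto simp: m_def)
    then have "y = y'" using m0 by simp
    moreover have "P = insert c T" "P' = insert c' T" using t t' e e' by auto
    ultimately show ?thesis using cc by simp
  next
    assume t: "T = P - {c}" and s: "s = c + of_nat (2 * card P) * (y - c)"
      and t': "T = P' - {y'}" and s': "s = c' + of_nat (4 * card P) * (y' - c')"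
    show ?thesis
    proof (rule FalseE, rule mixed[OF _ _ f t _ _ f' t'])
      show "finite P" "c \<in> P" using e by blast+
      show "s = c + 2 * m * (y - c)" "s = c' + 4 * m * (y' - c')"
        using s s' by (simp_all add: m_def)
      show "m * c = c + \<Sum>T" unfolding t sumP(1)[symmetric] by (rule rem) (use e in blast)
      show "m * c' = y' + \<Sum>T" unfolding t' sumP(2)[symmetric] by (rule rem') (use d in blast)
    qed
  next
    assume t: "T = P - {y}" and s: "s = c + of_nat (4 * card P) * (y - c)"
      and t': "T = P' - {c'}" and s': "s = c' + of_nat (2 * card P) * (y' - c')"
    show ?thesis
    proof (rule FalseE, rule mixed[OF _ _ f' t' _ _ f t])
      show "finite P'" "c' \<in> P'" using e' by blast+
      show "s = c' + 2 * m * (y' - c')" "s = c + 4 * m * (y - c)"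
        using s s' by (simp_all add: m_def)
      show "m * c' = c' + \<Sum>T" unfolding t' sumP(2)[symmetric] by (rule rem') (use e' in blast)
      show "m * c = y + \<Sum>T" unfolding t sumP(1)[symmetric] by (rule rem) (use d in blast)
    qed
  next
    assume t: "T = P - {y}" and s: "s = c + of_nat (4 * card P) * (y - c)"
      and t': "T = P' - {y'}" and s': "s = c' + of_nat (4 * card P) * (y' - c')"
    have q: "m * c = y + \<Sum>T" "m * c' = y' + \<Sum>T"
      unfolding sumP[symmetric] using rem[of y] rem'[of y'] d t t' by simp_all
    have "s = c + 4 * m * (y - c)" "s = c' + 4 * m * (y' - c')"
      using s s' by (simp_all add: m_def)
    \<comment> \<open>Eliminating \<open>c\<close> from the two linear equations expresses
      \<open>y - c\<close> by \<open>s\<close> and \<open>T\<close> alone.\<close>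
    moreover have "(m - 1) * s - \<Sum>T = (4 * m * (m - 1) + 1) * (y - c)"
      if "s = c + 4 * m * (y - c)" "m * c = y + \<Sum>T" for c y
    proof -
      have "\<Sum>T = m * c - y" using that(2) by simp
      then show ?thesis unfolding that(1) by (simp add: algebra_simps)
    qed
    ultimately have "(m - 1) * s - \<Sum>T = (4 * m * (m - 1) + 1) * (y - c)"
      "(m - 1) * s - \<Sum>T = (4 * m * (m - 1) + 1) * (y' - c')"
      using q by blast+
    then have dd: "y - c = y' - c'" using m0 by simp
    then have cc: "c = c'" using s s' by simp
    then have "y = y'" using dd by simp
    moreover have "P = insert y T" "P' = insert y' T" using t t' d by auto
    ultimately show ?thesis using cc by simp
  qed
qed

section \<open>The rule for one round and its equivariance\<close>

text \<open>Here \<open>x\<close> is the position that the robot at \<open>z\<close> had in \<open>P\<close>: the displaced robot came from the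
  only point of \<open>P\<close> that is missing in \<open>S\<close>.\<close>

definition decode_step :: "complex set \<Rightarrow> complex \<Rightarrow> complex \<Rightarrow> bool \<Rightarrow> bool" where
  "decode_step S z w b' \<longleftrightarrow> (\<exists>P c y x. encodes S P c y \<and> x \<in> P \<and> (x = z \<or> z \<notin> P \<and> x \<notin> S) \<and>
     is_next P c y x w \<and> (b' \<longleftrightarrow> w = c \<or> w = y))"

text \<open>One bit is enough to mark both \<open>c\<close> and \<open>y\<close>: a robot tells them
  apart by whether it stands on the centroid. Off the centroid, a marked robot takes its own
  position \<open>z\<close> for \<open>y\<close>.\<close>

definition reveal_step :: "complex set \<Rightarrow> complex \<Rightarrow> bool \<Rightarrow> complex \<Rightarrow> bool" where
  "reveal_step S z b w \<longleftrightarrow> (let c = centroid S; n = of_nat (card S) in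
     if z \<noteq> c then w = (if b then c + 4 * n * (z - c) else z)
     else if b then w = c
     else (\<exists>y. farthest S c y \<and> w = c + 2 * n * (y - c)))"

text \<open>The reference point \<open>centroid S + 1\<close> is arbitrary and not affinely invariant; the cyclic order
  does not depend on it, by \<open>is_next_reference\<close>.\<close>

definition step :: "complex set \<Rightarrow> complex \<Rightarrow> bool \<Rightarrow> complex \<Rightarrow> bool \<Rightarrow> bool" where
  "step S z b w b' \<longleftrightarrow>
     (if centroid S \<in> S then reveal_step S z b w \<and> b'
      else if b then decode_step S z w b'
      else is_next S (centroid S) (centroid S + 1) z w \<and> \<not> b')"

text \<open>Equivariance under orientation-preserving similarities lets each robot apply the rule in
  its own coordinates.\<close>

lemma step_affine:
  assumes "\<alpha> \<noteq> 0" "finite S" "z \<in> S" "step S z b w b'"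
  shows "step ((\<lambda>x. \<alpha> * x + \<beta>) ` S) (\<alpha> * z + \<beta>) b (\<alpha> * w + \<beta>) b'"
proof -
  let ?f = "\<lambda>x. \<alpha> * x + \<beta>"
  have inj: "inj ?f" using assms(1) by (auto intro: injI)
  have eq: "?f x = ?f y \<longleftrightarrow> x = y" for x y using assms(1) by simp
  have mem: "?f x \<in> ?f ` X \<longleftrightarrow> x \<in> X" for x X using inj by (rule inj_image_mem_iff)
  have card: "card (?f ` S) = card S" using inj by (intro card_image) (auto intro: inj_on_subset)
  have cen: "centroid (?f ` S) = ?f (centroid S)"
    using assms by (intro centroid_affine) auto
  have fk: "?f (x + k * (y - x)) = ?f x + k * (?f y - ?f x)" for x y k
    by (simp add: algebra_simps)
  note st = assms(4)[unfolded step_def]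
  show ?thesis
  proof (cases "centroid S \<in> S")
    case True
    have r: "reveal_step S z b w" and b': b' using st True by simp_all
    have "reveal_step (?f ` S) (?f z) b (?f w)"
    proof (cases "z = centroid S \<and> \<not> b")
      case True
      then obtain y where y: "farthest S z y" "w = z + 2 * of_nat (card S) * (y - z)"
        using r unfolding reveal_step_def Let_def by auto
      have "farthest (?f ` S) (?f z) (?f y)"
        using farthest_affine[OF assms(1) y(1)] .
      moreover have "?f w = ?f z + 2 * of_nat (card S) * (?f y - ?f z)"
        unfolding y(2) by (rule fk)
      moreover have "centroid (?f ` S) = ?f z" using cen True by simp
      ultimately show ?thesis
        using True unfolding reveal_step_def Let_def card by auto
    next
      case False
      then show ?thesis
        using r unfolding reveal_step_def Let_def cen card eq
        by (simp only: fk if_False split: if_splits) auto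
    qed
    then show ?thesis using b' True unfolding step_def cen mem by simp
  next
    case nmem: False
    show ?thesis
    proof (cases b)
      case True
      then have "decode_step S z w b'" using st nmem by simp
      then obtain P c y x where p: "encodes S P c y" "x \<in> P" "x = z \<or> z \<notin> P \<and> x \<notin> S"
        "is_next P c y x w" "b' \<longleftrightarrow> w = c \<or> w = y"
        unfolding decode_step_def by blast
      have "decode_step (?f ` S) (?f z) (?f w) b'"
        unfolding decode_step_def
        using encodes_affine[OF assms(1) p(1), of \<beta>] is_next_affine[OF assms(1) p(4), of \<beta>]
          p(2,3,5)
        by (intro exI[of _ "?f ` P"] exI[of _ "?f c"] exI[of _ "?f y"] exI[of _ "?f x"])
          (simp only: mem eq simp_thms)
      then show ?thesis using nmem True unfolding step_def cen mem by simp
    next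
      case False
      then have *: "is_next S (centroid S) (centroid S + 1) z w" and b': "\<not> b'"
        using st nmem by simp_all
      have "is_next (?f ` S) (?f (centroid S)) (?f (centroid S + 1)) (?f z) (?f w)"
        using is_next_affine[OF assms(1) *] .
      \<comment> \<open>The image of the reference point need not be the image centroid plus 1; with
        the centroid unoccupied the two references are interchangeable.\<close>
      then have "is_next (?f ` S) (?f (centroid S)) (?f (centroid S) + 1) (?f z) (?f w)"
        by (subst is_next_reference[of _ _ _ _ "?f (centroid S + 1)"])
          (use nmem assms(1,3) mem eq[of "centroid S + 1" "centroid S"] in auto)
      then show ?thesis using nmem False b' unfolding step_def cen mem by simp
    qed
  qed
qed


section \<open>Runs of the rule in the two cases\<close>

lemma decode_step_iff:
  assumes "encodes S P c y" "x \<in> P" "x = z \<or> z \<notin> P \<and> x \<notin> S"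
  shows "decode_step S z w b' \<longleftrightarrow> is_next P c y x w \<and> (b' \<longleftrightarrow> w = c \<or> w = y)"
proof
  assume "decode_step S z w b'"
  then obtain P' c' y' x' where p: "encodes S P' c' y'" "x' \<in> P'" "x' = z \<or> z \<notin> P' \<and> x' \<notin> S"
    "is_next P' c' y' x' w" "b' \<longleftrightarrow> w = c' \<or> w = y'"
    unfolding decode_step_def by blast
  have same: "P' = P" "c' = c" "y' = y" using encodes_unique[OF assms(1) p(1)] by auto
  \<comment> \<open>Only one point of \<open>P\<close> is vacated, so the former position
    \<open>x\<close> of the robot at \<open>z\<close> is unique.\<close>
  have "\<exists>q. P - S \<subseteq> {q}"
    by (rule encodes_cases[OF assms(1)]) blast
  then have "x' = x" using assms(2,3) p(2,3) unfolding same by blast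
  with p show "is_next P c y x w \<and> (b' \<longleftrightarrow> w = c \<or> w = y)" unfolding same by simp
next
  assume "is_next P c y x w \<and> (b' \<longleftrightarrow> w = c \<or> w = y)"
  then show "decode_step S z w b'" unfolding decode_step_def using assms by blast
qed

text \<open>The equivalence gives existence and uniqueness of the target, so moves along the cycle
  leave the robots no choice.\<close>

lemma ex_next_cycle:
  assumes "inj_on C {..<n}" "n \<ge> 2" "y \<noteq> c"
  shows "\<exists>\<pi>\<in>n_cycles n. \<forall>j<n. \<forall>w. is_next (C ` {..<n}) c y (C j) w \<longleftrightarrow> w = C (\<pi> j)"
proof -
  let ?P = "C ` {..<n}"
  have card: "card ?P = n" using assms(1) by (simp add: card_image)
  obtain e where e: "bij_betw e {..<n} ?P"
    "\<And>i w. i < n \<Longrightarrow> is_next ?P c y (e i) w \<longleftrightarrow> w = e ((i + 1) mod n)"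
    by (rule is_next_enumeration[of ?P n y c]) (use card assms in auto)
  define \<sigma> where "\<sigma> z = e ((inv_into {..<n} e z + 1) mod n)" for z
  have "\<sigma> (e i) = e ((i + 1) mod n)" if "i < n" for i
    using e(1) that by (simp add: \<sigma>_def bij_betw_inv_into_left)
  from n_cycle_of_successor[OF assms(1) refl assms(2) e(1) this]
  obtain \<pi> where \<pi>: "\<pi> \<in> n_cycles n" "\<forall>j<n. C (\<pi> j) = \<sigma> (C j)" by blast
  have "is_next ?P c y (C j) w \<longleftrightarrow> w = C (\<pi> j)" if "j < n" for j w
  proof -
    have "C j \<in> e ` {..<n}" using e(1) that by (simp add: bij_betw_def)
    then obtain i where "i < n" "C j = e i" by auto
    then show ?thesis using e \<pi>(2) that by (simp add: \<sigma>_def bij_betw_inv_into_left)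
  qed
  with \<pi>(1) show ?thesis by blast
qed

lemma n_cycles_funpow:
  assumes "\<pi> \<in> n_cycles n"
  shows "(\<pi> ^^ t) ` {..<n} = {..<n}"
proof -
  have "\<pi> ` {..<n} = {..<n}" using assms unfolding n_cycles_def by (auto simp: permutes_image)
  then show ?thesis by (induction t) (simp_all flip: image_image)
qed

text \<open>The occupied set never changes, so one \<open>\<pi>\<close> serves all rounds.
  \<open>H\<close> grants a legal move only where one exists, as a choice operator does; hence each
  round needs a witness.\<close>

lemma dynamics_centroid_unoccupied:
  assumes "inj_on (W 0) {..<n}" "n \<ge> 2" "\<And>i. \<not> B 0 i"
    and c: "centroid (W 0 ` {..<n}) \<notin> W 0 ` {..<n}"
    and H: "\<And>t i. i < n \<Longrightarrow> \<exists>w b'. step (W t ` {..<n}) (W t i) (B t i) w b' \<Longrightarrow>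
       step (W t ` {..<n}) (W t i) (B t i) (W (Suc t) i) (B (Suc t) i)"
  shows "\<exists>\<pi>\<in>n_cycles n. \<forall>t. \<forall>j<n. W t j = W 0 ((\<pi> ^^ t) j)"
proof -
  let ?P = "W 0 ` {..<n}"
  let ?c = "centroid ?P"
  obtain \<pi> where \<pi>: "\<pi> \<in> n_cycles n"
    and nx: "\<And>j w. j < n \<Longrightarrow> is_next ?P ?c (?c + 1) (W 0 j) w \<longleftrightarrow> w = W 0 (\<pi> j)"
    using ex_next_cycle[OF assms(1,2), of "?c + 1" ?c] by auto
  have "\<forall>j<n. W t j = W 0 ((\<pi> ^^ t) j) \<and> \<not> B t j" for t
  proof (induction t)
    case 0 show ?case using assms(3) by simp
  next
    case (Suc t)
    have "W t ` {..<n} = W 0 ` (\<pi> ^^ t) ` {..<n}" using Suc by (simp add: image_image)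
    then have P: "W t ` {..<n} = ?P" unfolding n_cycles_funpow[OF \<pi>] .
    show ?case
    proof (intro allI impI)
      fix j assume j: "j < n"
      have "(\<pi> ^^ t) j \<in> {..<n}" using n_cycles_funpow[OF \<pi>, of t] j by blast
      then have "step ?P (W t j) (B t j) w b' \<longleftrightarrow> w = W 0 (\<pi> ((\<pi> ^^ t) j)) \<and> \<not> b'" for w b'
        using c Suc j nx by (simp add: step_def)
      moreover have "\<exists>b'. \<not> b'" by blast
      ultimately show "W (Suc t) j = W 0 ((\<pi> ^^ Suc t) j) \<and> \<not> B (Suc t) j"
        using H[OF j, of t] unfolding P by simp
    qed
  qed
  with \<pi> show ?thesis by blast
qed

text \<open>A robot moves from \<open>q\<close> to \<open>s\<close>, turning \<open>V\<close> into
  \<open>V'\<close>. The second claim is the alternative that \<open>decode_step\<close> uses to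
  trace a robot back to its point of \<open>P\<close>.\<close>

lemma encodes_reveal:
  assumes "finite P" "c \<in> P" "centroid P = c" "farthest P c y" "V ` I = P"
    and q: "q = c \<and> s = c + of_nat (2 * card P) * (y - c) \<or>
            q = y \<and> s = c + of_nat (4 * card P) * (y - c)"
    and V': "\<And>j. j \<in> I \<Longrightarrow> V' j = (if V j = q then s else V j)"
  shows "encodes (V' ` I) P c y"
    and "j \<in> I \<Longrightarrow> V j = V' j \<or> V' j \<notin> P \<and> V j \<notin> V' ` I"
proof -
  have qP: "q \<in> P" using q assms by (auto simp: farthest_def)
  have S: "V' ` I = insert s (P - {q})"
    using V' qP unfolding assms(5)[symmetric] by (force simp: image_iff)
  have "V' ` I = insert (c + of_nat (2 * card P) * (y - c)) (P - {c}) \<or>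
      V' ` I = insert (c + of_nat (4 * card P) * (y - c)) (P - {y})"
    using q S by (elim disjE conjE) simp_all
  then show e: "encodes (V' ` I) P c y"
    unfolding encodes_def using assms(1-4) by (intro conjI)
  have n: "card P \<ge> 3" using card_ge_3[OF assms(1-4)] .
  have sP: "s \<notin> P"
    using q far_notin[OF assms(4), of "real (2 * card P)"] far_notin[OF assms(4), of "real (4 * card P)"] n
    by auto
  then show "V j = V' j \<or> V' j \<notin> P \<and> V j \<notin> V' ` I" if "j \<in> I"
    unfolding S using V'[OF that] qP by auto
qed

lemma dynamics_centroid_occupied:
  assumes inj: "inj_on (W 0) {..<n}" and n: "n \<ge> 2" and B0: "\<And>i. \<not> B 0 i"
    and c: "centroid (W 0 ` {..<n}) \<in> W 0 ` {..<n}"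
    and H: "\<And>t i. i < n \<Longrightarrow> \<exists>w b'. step (W t ` {..<n}) (W t i) (B t i) w b' \<Longrightarrow>
       step (W t ` {..<n}) (W t i) (B t i) (W (Suc t) i) (B (Suc t) i)"
  shows "\<exists>\<pi>\<in>n_cycles n. \<forall>t. \<forall>j<n. W (2 * t) j = W 0 ((\<pi> ^^ t) j)"
proof -
  define P where "P = W 0 ` {..<n}"
  define c where "c = centroid P"
  have fin: "finite P" and card: "card P = n" and cP: "c \<in> P" "centroid P = c"
    using inj c by (simp_all add: P_def c_def card_image)
  have ex_far: "\<exists>y. farthest P c y" using farthest_exists[OF fin] card n by simp
  have reveal: "step P z b w b' \<longleftrightarrow> reveal_step P z b w \<and> b'" for z b w b'
    using cP by (simp add: step_def)
  have ex_reveal: "\<exists>w b'. step P z b w b'" for z b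
    unfolding reveal reveal_step_def Let_def cP(2) using ex_far by auto
  obtain i0 where i0: "i0 < n" "W 0 i0 = c" using cP by (auto simp: P_def)
  \<comment> \<open>\<open>y\<close> is read off from the first move of the robot at
    \<open>c\<close>, whichever farthest point it chose, and is kept for the whole run.\<close>
  have "step P c False (W 1 i0) (B 1 i0)"
    using H[OF i0(1), of 0] ex_reveal B0 i0(2) by (simp add: P_def)
  then obtain y where y: "farthest P c y" "W 1 i0 = c + 2 * of_nat n * (y - c)"
    unfolding reveal reveal_step_def Let_def cP(2) card by auto
  have yc: "y \<noteq> c" using y(1) by (simp add: farthest_def)
  obtain \<pi> where \<pi>: "\<pi> \<in> n_cycles n"
    and nx: "\<And>j w. j < n \<Longrightarrow> is_next P c y (W 0 j) w \<longleftrightarrow> w = W 0 (\<pi> j)"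
    using ex_next_cycle[OF inj n yc] unfolding P_def by blast
  \<comment> \<open>The induction runs over pairs of rounds. No position is marked at the start;
    afterwards the bit is 1 exactly at \<open>c\<close> and \<open>y\<close>.\<close>
  have "\<forall>j<n. W (2 * t) j = W 0 ((\<pi> ^^ t) j) \<and>
      (if t = 0 then \<not> B (2 * t) j else B (2 * t) j \<longleftrightarrow> W (2 * t) j = c \<or> W (2 * t) j = y)" for t
  proof (induction t)
    case 0 show ?case using B0 by simp
  next
    case (Suc t)
    let ?V = "W (2 * t)" and ?V' = "W (Suc (2 * t))"
    have "?V ` {..<n} = W 0 ` (\<pi> ^^ t) ` {..<n}" using Suc by (simp add: image_image)
    then have VP: "?V ` {..<n} = P" unfolding n_cycles_funpow[OF \<pi>] P_def .
    have st: "reveal_step P (?V j) (B (2 * t) j) (?V' j) \<and> B (Suc (2 * t)) j" if "j < n" for j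
      using H[OF that, of "2 * t"] ex_reveal unfolding VP reveal by blast
    \<comment> \<open>Exactly one point is vacated: \<open>c\<close> in the first round,
      \<open>y\<close> in every later even round.\<close>
    have "\<exists>q s. (q = c \<and> s = c + of_nat (2 * card P) * (y - c) \<or>
            q = y \<and> s = c + of_nat (4 * card P) * (y - c)) \<and>
          (\<forall>j<n. ?V' j = (if ?V j = q then s else ?V j))"
    proof (cases "t = 0")
      case True
      have "?V' j = (if ?V j = c then c + of_nat (2 * card P) * (y - c) else ?V j)" if j: "j < n" for j
      proof (cases "?V j = c")
        case True
        then have "j = i0" using inj_onD[OF inj, of j i0] i0 j \<open>t = 0\<close> by simp
        then show ?thesis using True y(2) \<open>t = 0\<close> card by simp
      next
        case False
        then show ?thesis using st[OF j] B0 \<open>t = 0\<close>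
          unfolding reveal_step_def Let_def cP(2) by simp
      qed
      then show ?thesis by blast
    next
      case False
      have "?V' j = (if ?V j = y then c + of_nat (4 * card P) * (y - c) else ?V j)" if j: "j < n" for j
        using st[OF j] Suc j False yc unfolding reveal_step_def Let_def cP(2)
        by (auto split: if_splits)
      then show ?thesis by blast
    qed
    then obtain q s where "q = c \<and> s = c + of_nat (2 * card P) * (y - c) \<or>
            q = y \<and> s = c + of_nat (4 * card P) * (y - c)"
          "\<And>j. j \<in> {..<n} \<Longrightarrow> ?V' j = (if ?V j = q then s else ?V j)"
      by auto
    note er = encodes_reveal[OF fin cP y(1) VP this]
    show ?case
    proof (intro allI impI)
      fix j assume j: "j < n"
      have \<pi>j: "(\<pi> ^^ t) j < n" using n_cycles_funpow[OF \<pi>, of t] j by blast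
      have "?V j \<in> P" using VP j by blast
      then have "decode_step (?V' ` {..<n}) (?V' j) w b' \<longleftrightarrow>
          is_next P c y (?V j) w \<and> (b' \<longleftrightarrow> w = c \<or> w = y)" for w b'
        using decode_step_iff[OF er(1)] er(2) j by blast
      then have "step (?V' ` {..<n}) (?V' j) (B (Suc (2 * t)) j) w b' \<longleftrightarrow>
          w = W 0 (\<pi> ((\<pi> ^^ t) j)) \<and> (b' \<longleftrightarrow> w = c \<or> w = y)" for w b'
        unfolding step_def using centroid_encodes[OF er(1)] st[OF j] Suc j nx[OF \<pi>j] by simp
      with H[OF j, of "Suc (2 * t)"]
      show "W (2 * Suc t) j = W 0 ((\<pi> ^^ Suc t) j) \<and>
        (if Suc t = 0 then \<not> B (2 * Suc t) j
         else B (2 * Suc t) j \<longleftrightarrow> W (2 * Suc t) j = c \<or> W (2 * Suc t) j = y)"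
        by auto
    qed
  qed
  with \<pi> show ?thesis by blast
qed

section \<open>Local frames as complex multiplications, and the algorithm\<close>

text \<open>The sign \<open>s\<close> is the common handedness of the frames. Reflecting the global
  plane for \<open>s = - 1\<close> makes every change of frame orientation-preserving.\<close>

definition to_complex :: "real \<Rightarrow> point \<Rightarrow> complex" where
  "to_complex s v = Complex (v $ 1) (s * v $ 2)"

definition of_complex :: "complex \<Rightarrow> point" where
  "of_complex z = vector [Re z, Im z]"

lemma to_complex_of_complex: "to_complex 1 (of_complex z) = z"
  by (simp add: to_complex_def of_complex_def)

lemma to_complex_add: "to_complex s (v + w) = to_complex s v + to_complex s w"
  and to_complex_diff: "to_complex s (v - w) = to_complex s v - to_complex s w"
  by (simp_all add: to_complex_def complex_eq_iff algebra_simps)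

lemma inj_to_complex: "s \<noteq> 0 \<Longrightarrow> inj (to_complex s)"
  by (rule injI) (simp add: to_complex_def vec_eq_iff forall_2)

lemma to_complex_minus: "to_complex (- 1) v = cnj (to_complex 1 v)"
  by (simp add: to_complex_def complex_eq_iff)

lemma centroid_cnj: "centroid (cnj ` S) = cnj (centroid S)"
proof -
  have i: "inj_on cnj S" by (rule inj_onI) simp
  show ?thesis unfolding centroid_def card_image[OF i] sum.reindex[OF i] by simp
qed

text \<open>Orthonormal columns with determinant \<open>s\<close> force \<open>t = s * p\<close> and
  \<open>q = - s * r\<close>. After the reflection given by \<open>s\<close>, the matrix is a scaled
  rotation, that is, multiplication by \<open>a\<close>.\<close>

lemma cartesian_frame_complex:
  assumes "cartesian_frame M" "sgn (det M) = s"
  shows "s \<in> {1, -1} \<and> invertible M \<and> (\<exists>a. a \<noteq> 0 \<and> (\<forall>v. to_complex s (M *v v) = a * to_complex 1 v))"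
proof -
  obtain u Q where u: "u > 0" "orthogonal_matrix Q" "M = u *\<^sub>R Q"
    using assms(1) unfolding cartesian_frame_def by blast
  define p q r t where "p = Q $ 1 $ 1" and "q = Q $ 1 $ 2" and "r = Q $ 2 $ 1" and "t = Q $ 2 $ 2"
  note pq = p_def q_def r_def t_def
  have "transpose Q ** Q = mat 1" using u(2) unfolding orthogonal_matrix_def by blast
  then have o: "p * p + r * r = 1" "p * q + r * t = 0"
    unfolding pq by (simp_all add: vec_eq_iff forall_2 matrix_matrix_mult_def transpose_def sum_2 mat_def)
  have d: "det Q = p * t - q * r" unfolding pq by (rule det_2)
  have dM: "det M = u * u * (p * t - q * r)"
    unfolding u(3) det_2 pq by (simp add: algebra_simps)
  have d1: "p * t - q * r = 1 \<or> p * t - q * r = -1"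
    using det_orthogonal_matrix[OF u(2)] d by simp
  have inv: "invertible M" unfolding invertible_det_nz dM using d1 u(1) by auto
  have "sgn (det M) = p * t - q * r"
    unfolding dM using d1 u(1) by (auto simp: sgn_mult)
  then have s: "s = p * t - q * r" using assms(2) by simp
  have rt: "r * t = - (p * q)" using o(2) by linarith
  have "s * p = p * (p * t) - r * (p * q)" unfolding s by (simp add: algebra_simps)
  also have "\<dots> = p * (p * t) + r * (r * t)" unfolding rt by simp
  also have "\<dots> = (p * p + r * r) * t" by (simp add: algebra_simps)
  finally have t: "t = s * p" using o by simp
  have "s * r = r * (p * t) - q * (r * r)" unfolding s by (simp add: algebra_simps)
  also have "r * (p * t) = p * (r * t)" by simp
  also note rt
  also have "p * - (p * q) - q * (r * r) = - q * (p * p + r * r)" by (simp add: algebra_simps)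
  finally have q: "q = - s * r" using o by simp
  have s1: "s \<in> {1, -1}" using s d1 by auto
  define a where "a = Complex (u * p) (s * u * r)"
  have "p \<noteq> 0 \<or> r \<noteq> 0" using o(1) by auto
  then have "a \<noteq> 0" using u(1) s1 by (auto simp: a_def complex_eq_iff)
  moreover have "to_complex s (M *v v) = a * to_complex 1 v" for v
  proof -
    have "(M *v v) $ 1 = u * (p * v $ 1 + q * v $ 2)" "(M *v v) $ 2 = u * (r * v $ 1 + t * v $ 2)"
      unfolding u(3) pq by (simp_all add: matrix_vector_mult_def sum_2 algebra_simps)
    then show ?thesis using s1
      unfolding to_complex_def a_def t q by (auto simp: complex_eq_iff algebra_simps)
  qed
  ultimately show ?thesis using s1 inv by blast
qed

text \<open>\<open>SOME\<close> turns the relation \<open>step\<close> into a function, as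
  determinism requires. Local coordinates are always read with sign 1, since the global handedness
  is unknown to a robot.\<close>

definition visit_all :: algorithm where
  "visit_all = (\<lambda>(T, b).
     let r = SOME r. step (to_complex 1 ` set_mset T) 0 b (fst r) (snd r)
     in (of_complex (fst r), snd r))"

lemma one_round_visit_all:
  assumes "cartesian_frame (Z i)" "sgn (det (Z i)) = s" "i < n"
    and ex: "\<exists>w b'. step ((\<lambda>j. to_complex s (C j)) ` {..<n}) (to_complex s (C i)) (b i) w b'"
  shows "step ((\<lambda>j. to_complex s (C j)) ` {..<n}) (to_complex s (C i)) (b i)
    (to_complex s (fst (one_round visit_all n Z (C, b)) i)) (snd (one_round visit_all n Z (C, b)) i)"
proof -
  define S where "S = (\<lambda>j. to_complex s (C j)) ` {..<n}"
  define p where "p = to_complex s (C i)"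
  obtain a where a: "a \<noteq> 0" "\<And>v. to_complex s (Z i *v v) = a * to_complex 1 v"
    and inv: "invertible (Z i)"
    using cartesian_frame_complex[OF assms(1,2)] by blast
  have fin: "finite S" and pS: "p \<in> S" using assms(3) by (auto simp: S_def p_def)
  \<comment> \<open>The passage from global to local complex coordinates; its inverse is
    \<open>x \<mapsto> a * x + p\<close>.\<close>
  define f where "f x = (1 / a) * x + (- p / a)" for x
  have loc: "to_complex 1 (to_local (Z i) (C i) (C j)) = f (to_complex s (C j))" for j
  proof -
    have "Z i *v (to_local (Z i) (C i) (C j)) = C j - C i"
      using inv unfolding to_local_def matrix_vector_mul_assoc invertible_def matrix_inv_def
      by (metis (mono_tags, lifting) matrix_vector_mul_lid someI_ex)
    then have "a * to_complex 1 (to_local (Z i) (C i) (C j)) = to_complex s (C j) - p"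
      using a(2) by (metis to_complex_diff p_def)
    then show ?thesis using a(1) by (simp add: f_def field_simps)
  qed
  have snap: "to_complex 1 ` set_mset (snapshot n Z C i) = f ` S"
    unfolding snapshot_def S_def by (simp add: image_image loc)
  have fp: "f p = 0" by (simp add: f_def)
  define r where "r = (SOME r. step (f ` S) 0 (b i) (fst r) (snd r))"
  obtain w b' where "step S p (b i) w b'" using ex unfolding S_def p_def by blast
  then have "step (f ` S) 0 (b i) (f w) b'"
    using step_affine[of "1 / a" S p "b i" w b' "- p / a", folded f_def] a(1) fin pS fp by simp
  then have "\<exists>r. step (f ` S) 0 (b i) (fst r) (snd r)" by (metis fst_conv snd_conv)
  then have r: "step (f ` S) 0 (b i) (fst r) (snd r)" unfolding r_def by (rule someI_ex)
  \<comment> \<open>The chosen \<open>r\<close> is carried back, not \<open>w\<close>: the two may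
    differ when there are several farthest points.\<close>
  have "step ((\<lambda>x. a * x + p) ` f ` S) (a * 0 + p) (b i) (a * fst r + p) (snd r)"
    using r a(1) fin pS fp by (intro step_affine) (auto intro: image_eqI[of _ f p])
  moreover have "(\<lambda>x. a * x + p) ` f ` S = S"
    unfolding image_image f_def using a(1) by (simp add: field_simps)
  ultimately have "step S p (b i) (a * fst r + p) (snd r)" by simp
  moreover have "visit_all (snapshot n Z C i, b i) = (of_complex (fst r), snd r)"
    unfolding visit_all_def r_def by (simp add: snap Let_def)
  moreover have "to_complex s (to_global (Z i) (C i) (of_complex (fst r))) = a * fst r + p"
    unfolding to_global_def to_complex_add a(2) to_complex_of_complex p_def by simp
  ultimately show ?thesis
    unfolding one_round_def S_def p_def by simp
qed

theorem theorem16: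
  shows "\<exists>A :: algorithm. \<forall>n\<ge>2. \<forall>C\<^sub>0. initial_config n C\<^sub>0 \<longrightarrow>
           (\<exists>k\<in>{1, 2}. solves_visit_all A n k C\<^sub>0)"
proof (intro exI[of _ visit_all] allI impI)
  fix n :: nat and C\<^sub>0 :: config
  assume n: "n \<ge> 2" and init: "initial_config n C\<^sub>0"
  define Q where "Q s = (\<lambda>j. to_complex s (C\<^sub>0 j)) ` {..<n}" for s
  define occ where "occ \<longleftrightarrow> centroid (Q 1) \<in> Q 1"
  \<comment> \<open>The number of steps may depend on the initial configuration but not on the
    frames; conjugation shows that both handednesses agree on whether the centroid is
    occupied.\<close>
  have "Q (- 1) = cnj ` Q 1" by (simp add: Q_def to_complex_minus image_image)
  then have occ: "centroid (Q s) \<in> Q s \<longleftrightarrow> occ" if "s \<in> {1, -1}" for s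
    using that by (auto simp: occ_def centroid_cnj inj_image_mem_iff[OF injI])
  let ?k = "if occ then 2 else 1 :: nat"
  have "solves_visit_all visit_all n ?k C\<^sub>0"
    unfolding solves_visit_all_def
  proof (intro allI impI)
    fix Z assume Z: "admissible_frames n Z"
    define s where "s = sgn (det (Z 0))"
    have fr: "cartesian_frame (Z i)" "sgn (det (Z i)) = s" if "i < n" for i
    proof -
      have "0 < n" using n by simp
      then show "cartesian_frame (Z i)" "sgn (det (Z i)) = s"
        using Z that unfolding admissible_frames_def s_def by blast+
    qed
    have s: "s \<in> {1, -1}" using cartesian_frame_complex[OF fr[of 0]] n by auto
    then have inj_s: "inj (to_complex s)" by (intro inj_to_complex) auto
    define st where "st t = (one_round visit_all n Z ^^ t) (C\<^sub>0, \<lambda>_. False)" for t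
    define W where "W t j = to_complex s (fst (st t) j)" for t j
    define B where "B t = snd (st t)" for t
    have H: "step (W t ` {..<n}) (W t i) (B t i) (W (Suc t) i) (B (Suc t) i)"
      if "i < n" "\<exists>w b'. step (W t ` {..<n}) (W t i) (B t i) w b'" for t i
    proof -
      have "st (Suc t) = one_round visit_all n Z (fst (st t), snd (st t))" by (simp add: st_def)
      then show ?thesis
        using one_round_visit_all[where C = "fst (st t)" and b = "snd (st t)" and Z = Z and i = i, OF fr[OF that(1)] that(1)] that(2)
        unfolding W_def B_def by simp
    qed
    have W0: "W 0 = (\<lambda>j. to_complex s (C\<^sub>0 j))" by (simp add: fun_eq_iff W_def st_def)
    have inj0: "inj_on (W 0) {..<n}"
      unfolding W0 using init inj_s unfolding initial_config_def
      by (auto intro!: inj_onI dest: injD inj_onD)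
    have B0: "\<not> B 0 i" for i by (simp add: B_def st_def)
    have "\<exists>\<pi>\<in>n_cycles n. \<forall>t. \<forall>j<n. W (t * ?k) j = W 0 ((\<pi> ^^ t) j)"
    proof (cases occ)
      case True
      then show ?thesis
        using dynamics_centroid_occupied[of W n B, OF inj0 n B0 _ H] occ[OF s] unfolding Q_def W0
        by (simp add: mult.commute)
    next
      case False
      then show ?thesis
        using dynamics_centroid_unoccupied[of W n B, OF inj0 n B0 _ H] occ[OF s] unfolding Q_def W0
        by simp
    qed
    moreover have "run visit_all n Z C\<^sub>0 t j = C\<^sub>0 m \<longleftrightarrow> W t j = W 0 m" for t j m
      using inj_s by (simp add: run_def W0 W_def st_def inj_eq)
    ultimately show "\<exists>\<pi>\<in>n_cycles n. \<forall>i. \<forall>j<n. run visit_all n Z C\<^sub>0 (i * ?k) j = C\<^sub>0 ((\<pi> ^^ i) j)"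
      by simp
  qed
  moreover have "?k \<in> {1, 2}" by simp
  ultimately show "\<exists>k\<in>{1, 2}. solves_visit_all visit_all n k C\<^sub>0" by blast
qed

end
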